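(* Let $k \geq 5$ be an integer. Then for every integer $n \geq 2k$, $p_1 p_2 \cdots p_n > p_{n+1}^k$.
   Context: $p_n$ denotes the $n$th prime (so $p_1 = 2$, $p_2 = 3$, $p_3 = 5$, ...). *)

theory Defs
  imports "HOL-Library.Infinite_Set" "HOL-Computational_Algebra.Primes"
begin

(* The library's enumerate counts from 0; here p_1 = 2, p_2 = 3, ...
   The value at 0 is junk, equal to nth_prime 1 by truncated subtraction. *)
definition nth_prime :: "nat \<Rightarrow> nat" where
  "nth_prime n = enumerate {p. prime p} (n - 1)"

lemma nth_prime_1: "nth_prime 1 = 2"
  unfolding nth_prime_def
  by (auto simp: enumerate_0 intro!: Least_equality prime_ge_2_nat)

lemma nth_prime_less_nth_prime_Suc:
  assumes "n \<ge> 1"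
  shows "nth_prime n < nth_prime (Suc n)"
  using enumerate_mono[OF _ primes_infinite, of "n - 1" n] assms
  by (simp add: nth_prime_def)

lemma bij_betw_nth_prime: "bij_betw nth_prime {1..} {p. prime p}"
proof -
  have "bij_betw (\<lambda>n::nat. n - 1) {1..} UNIV"
    by (rule bij_betw_byWitness[where f' = Suc]) auto
  from bij_betw_trans[OF this bij_enumerate[OF primes_infinite]]
  show ?thesis
    by (simp add: nth_prime_def[abs_def] comp_def)
qed

end

(* Write N for p_(n+1), so that the claim follows from N^n < (p_1 ... p_n)^2, where the
   p_i are the primes below N.  A prime p >= N^(2/3) gains p^2 >= N^(4/3), hence covers its own
   factor N with N^(1/3) to spare; a prime p >= N^(1/2) covers its own factor; a prime p < N^(1/2)
   lacks at most one factor N.  So it is enough that the primes below N outnumber those below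
   N^(2/3) plus three times those below N^(1/2).  For N >= 4096 this follows from counting odd
   numbers for the latter two and from Chebyshev's lower bound for pi(N), which comes from the
   fact that m * binomial(2m, m) divides lcm(1, ..., 2m).
   For smaller N an explicit set S of primes does: if S contains all primes below N^(1/2) and
   N^|S| < (prod S)^2, the remaining primes can only help, and one S serves a long range of N. *)
theory Submission
  imports Defs Complex_Main
begin

section \<open>Chebyshev's lower bound for the number of primes\<close>

text \<open>In Leibniz's harmonic triangle \<open>1 / D\<close> is the difference of
  \<open>1 / B\<close> and \<open>1 / A\<close>, two entries with the smaller index
  \<open>k\<close>. By induction \<open>A\<close> and \<open>B\<close> divide the lcm
  \<open>L\<close>, so L/D = L/B - L/A is an integer.\<close>

lemma Suc_times_binomial_dvd_Lcm:
  "k \<le> n \<Longrightarrow> Suc n * (n choose k) dvd Lcm {1..Suc n}"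
proof (induction k arbitrary: n)
  case 0
  then show ?case by (auto intro: dvd_Lcm)
next
  case (Suc k)
  then obtain m where n: "n = Suc m"
    by (cases n) auto
  let ?L = "Lcm {1..Suc n}"
  define A where "A = Suc n * (n choose k)"
  define B where "B = Suc m * (m choose k)"
  define D where "D = Suc n * (n choose Suc k)"
  have km: "k \<le> n" "k \<le> m" using Suc.prems n by auto
  have AL: "A dvd ?L" unfolding A_def using Suc.IH[OF km(1)] .
  have "B dvd Lcm {1..n}" unfolding B_def n using Suc.IH[OF km(2)] .
  also have "Lcm {1..n} dvd ?L"
    by (rule Lcm_subset) auto
  finally have BL: "B dvd ?L" .
  from AL BL obtain u v where u: "?L = A * u" and v: "?L = B * v"
    by (elim dvdE)
  have e1: "A = Suc k * (Suc n choose Suc k)"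
    unfolding A_def using Suc_times_binomial_eq[of n k] by (simp add: mult.commute)
  have e2: "B = Suc k * (n choose Suc k)"
    unfolding B_def n using Suc_times_binomial_eq[of m k] by (simp add: mult.commute)
  \<comment> \<open>Leibniz's harmonic triangle: \<open>1 / A + 1 / D = 1 / B\<close>.\<close>
  have key: "D * A = A * B + D * B"
  proof -
    have "D * A = Suc n * B * (Suc n choose Suc k)"
      unfolding D_def e1 e2 by (simp only: mult_ac)
    also have "\<dots> = Suc n * B * ((n choose k) + (n choose Suc k))"
      by simp
    also have "\<dots> = A * B + D * B"
      unfolding A_def D_def by (simp only: algebra_simps)
    finally show ?thesis .
  qed
  have pos: "A * B > 0"
    using km by (simp add: A_def B_def)
  \<comment> \<open>This is 1/D = 1/B - 1/A times L*D, with denominators cleared and the subtraction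
    moved across to stay within the natural numbers.\<close>
  have "(A * B) * (D * v) = (A * B) * (?L + D * u)"
  proof -
    have "(A * B) * (D * v) = D * A * ?L" unfolding v by (simp only: mult_ac)
    also have "\<dots> = A * B * ?L + D * B * ?L" unfolding key by (rule distrib_right)
    also have "D * B * ?L = (A * B) * (D * u)" unfolding u by (simp only: mult_ac)
    finally show ?thesis by (simp only: distrib_left)
  qed
  with pos have "D * v = ?L + D * u" by simp
  then have "D dvd ?L + D * u" by (metis dvd_triv_left)
  then show ?case
    unfolding D_def by (simp only: dvd_add_left_iff dvd_triv_left)
qed

text \<open>The multiplicity of a prime in an lcm is the maximum of its multiplicities, so
  \<open>p ^ j\<close> already divides one of 1, ..., n.\<close>

lemma prime_power_dvd_Lcm_imp_le:
  fixes p :: nat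
  assumes "prime p" "p ^ j dvd Lcm {1..n}" "n \<ge> 1"
  shows "p ^ j \<le> n"
  using assms(3,2)
proof (induction n rule: dec_induct)
  case base
  then show ?case by auto
next
  case (step n)
  have "{1..Suc n} = insert (Suc n) {1..n}" using step by auto
  then have L: "Lcm {1..Suc n} = lcm (Suc n) (Lcm {1..n})" by simp
  have nz: "Lcm {1..n} \<noteq> (0::nat)" by (simp add: Lcm_0_iff)
  have "j \<le> multiplicity p (Lcm {1..Suc n})"
    using step.prems nz assms(1) unfolding L
    by (intro multiplicity_geI) auto
  also have "\<dots> = max (multiplicity p (Suc n)) (multiplicity p (Lcm {1..n}))"
    unfolding L using nz assms(1) by (intro multiplicity_lcm) auto
  finally consider "p ^ j dvd Suc n" | "p ^ j dvd Lcm {1..n}"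
    by (meson le_max_iff_disj multiplicity_dvd')
  then show ?case
  proof cases
    case 1 then show ?thesis by (simp add: dvd_imp_le)
  next
    case 2 then show ?thesis using step.IH by simp
  qed
qed

text \<open>Each prime power in the factorisation of \<open>d\<close> is at most \<open>n\<close>,
  and only primes up to \<open>n\<close> occur.\<close>

lemma dvd_Lcm_imp_le_power_card_primes:
  fixes d :: nat
  assumes "d dvd Lcm {1..n}" "n \<ge> 1"
  shows "d \<le> n ^ card {p. prime p \<and> p \<le> n}"
proof -
  have "Lcm {1..n} \<noteq> (0::nat)" by (simp add: Lcm_0_iff)
  with assms(1) have d0: "d \<noteq> 0" by (metis dvd_0_left)
  have le: "p ^ multiplicity p d \<le> n" if "prime p" for p
    using that assms multiplicity_dvd[of p d]
    by (intro prime_power_dvd_Lcm_imp_le) (auto intro: dvd_trans)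
  have sub: "prime_factors d \<subseteq> {p. prime p \<and> p \<le> n}"
  proof (clarsimp simp: prime_factors_dvd d0)
    fix p assume "prime p" "p dvd d"
    then show "p \<le> n"
      using prime_power_dvd_Lcm_imp_le[of p 1 n] assms by (auto intro: dvd_trans)
  qed
  have "d = (\<Prod>p\<in>prime_factors d. p ^ multiplicity p d)"
    using prod_prime_factors[OF d0] by simp
  also have "\<dots> \<le> (\<Prod>p\<in>prime_factors d. n)"
    using le by (intro prod_mono) (auto simp: prime_factors_dvd)
  also have "\<dots> = n ^ card (prime_factors d)" by simp
  also have "\<dots> \<le> n ^ card {p. prime p \<and> p \<le> n}"
    using sub assms(2) by (intro power_increasing card_mono) auto
  finally show ?thesis .
qed

text \<open>The extra factor m cancels the m in the bound 4^m / (2m) for the central binomial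
  coefficient, and the product still divides the lcm.\<close>

lemma power_card_primes_ge:
  assumes "m \<ge> 1"
  shows "4 ^ m \<le> 2 * (2 * m) ^ card {p. prime p \<and> p \<le> 2 * m}"
proof -
  \<comment> \<open>Absorption gives the shape \<open>Suc n * (n choose k)\<close> with n = 2m - 1,
    so that the lcm runs up to 2m exactly.\<close>
  have "m * (2 * m choose m) = 2 * m * (2 * m - 1 choose (m - 1))"
    using assms times_binomial_minus1_eq[of m "2 * m"] by simp
  also have "\<dots> = Suc (2 * m - 1) * (2 * m - 1 choose (m - 1))"
    using assms by simp
  also have "\<dots> dvd Lcm {1..Suc (2 * m - 1)}"
    by (rule Suc_times_binomial_dvd_Lcm) (use assms in auto)
  also have "Suc (2 * m - 1) = 2 * m" using assms by simp
  finally have le: "m * (2 * m choose m) \<le> (2 * m) ^ card {p. prime p \<and> p \<le> 2 * m}"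
    using assms by (intro dvd_Lcm_imp_le_power_card_primes) auto
  have "4 ^ m / (2 * real m) \<le> real (2 * m choose m)"
    using central_binomial_lower_bound[of m] assms by simp
  then have "real (4 ^ m) \<le> real (2 * (m * (2 * m choose m)))"
    using assms by (simp add: field_simps)
  then have "4 ^ m \<le> 2 * (m * (2 * m choose m))"
    by (simp only: of_nat_le_iff)
  with le show ?thesis by simp
qed

section \<open>Upper bounds from odd numbers; adding primes to a set\<close>

lemma card_primes_le: "card {p::nat. prime p \<and> p \<le> n} \<le> (n + 1) div 2"
proof (cases "n \<ge> 2")
  case True
  \<comment> \<open>The map sends 2 to 0 and an odd prime \<open>2 i + 1\<close> to \<open>i \<ge> 1\<close>.\<close>
  have "inj_on (\<lambda>p. if p = 2 then 0 else p div 2) {p::nat. prime p \<and> p \<le> n}"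
  proof (rule inj_onI)
    fix p q :: nat
    assume a: "p \<in> {p. prime p \<and> p \<le> n}" "q \<in> {p. prime p \<and> p \<le> n}"
      "(if p = 2 then 0 else p div 2) = (if q = 2 then 0 else q div 2)"
    have odd: "odd r \<and> r \<ge> 3" if "prime r" "r \<noteq> 2" for r :: nat
      using that prime_odd_nat[of r] prime_ge_2_nat[of r] by auto
    have "p \<noteq> 2 \<Longrightarrow> odd p \<and> p \<ge> 3" "q \<noteq> 2 \<Longrightarrow> odd q \<and> q \<ge> 3"
      using a odd by auto
    with a(3) show "p = q"
      by (cases "p = 2"; cases "q = 2") (auto elim!: oddE)
  qed
  moreover have "(if p = 2 then 0 else p div 2) < (n + 1) div 2" if "prime p" "p \<le> n" for p
    using that True prime_odd_nat[of p] prime_ge_2_nat[of p] by (cases "p = 2") (auto elim!: oddE)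
  ultimately have "card {p::nat. prime p \<and> p \<le> n} \<le> card {..<(n + 1) div 2}"
    by (intro card_inj_on_le) auto
  then show ?thesis by simp
next
  case False
  then have "{p::nat. prime p \<and> p \<le> n} = {}"
    by (auto dest: prime_ge_2_nat)
  then show ?thesis by (simp only: card.empty)
qed

text \<open>A prime p < N outside \<open>S\<close> has p^2 >= N, so adjoining it multiplies the left
  side by N and the right side by at least N.\<close>

lemma prod_primes_gt_of_subset:
  fixes N :: nat and S :: "nat set"
  assumes "S \<subseteq> {p. prime p \<and> p < N}"
    and "{p. prime p \<and> p\<^sup>2 < N} \<subseteq> S"
    and "N ^ card S < (\<Prod>S)\<^sup>2"
  shows "N ^ card {p. prime p \<and> p < N} < (\<Prod>{p. prime p \<and> p < N})\<^sup>2"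
proof -
  let ?Q = "{p. prime p \<and> p < N}"
  have fin: "finite ?Q" by simp
  have "N ^ card ?Q = N ^ card S * N ^ card (?Q - S)"
    using assms(1) fin by (metis card_Diff_subset card_mono finite_subset
        le_add_diff_inverse power_add)
  also have "N ^ card (?Q - S) = (\<Prod>p\<in>?Q - S. N)" by simp
  also have "\<dots> \<le> (\<Prod>p\<in>?Q - S. p\<^sup>2)"
    using assms(2) by (intro prod_mono) (auto simp: not_less)
  also have "N ^ card S * \<dots> < (\<Prod>S)\<^sup>2 * (\<Prod>p\<in>?Q - S. p\<^sup>2)"
    using assms(3) by (intro mult_strict_right_mono) (auto intro!: prod_pos simp: prime_gt_0_nat)
  also have "\<dots> = (\<Prod>?Q)\<^sup>2"
    using prod.subset_diff[OF assms(1) fin, of "\<lambda>p. p"]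
    by (simp add: prod_power_distrib power_mult_distrib mult.commute)
  finally show ?thesis by simp
qed

lemma card_primes_le_real:
  fixes y :: real
  assumes "y \<ge> 0"
  shows "real (card {p::nat. prime p \<and> real p \<le> y}) \<le> (y + 1) / 2"
proof -
  have "{p::nat. prime p \<and> real p \<le> y} = {p. prime p \<and> p \<le> nat \<lfloor>y\<rfloor>}"
    using assms by (auto simp: le_nat_floor le_nat_iff le_floor_iff)
  then have "card {p::nat. prime p \<and> real p \<le> y} \<le> (nat \<lfloor>y\<rfloor> + 1) div 2"
    using card_primes_le by simp
  then have "2 * real (card {p::nat. prime p \<and> real p \<le> y}) \<le> real (nat \<lfloor>y\<rfloor>) + 1"
    by linarith
  also have "real (nat \<lfloor>y\<rfloor>) \<le> y" using assms by simp
  finally show ?thesis by simp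
qed

section \<open>Large N\<close>

text \<open>Otherwise the number n of primes below N is at most about N^(2/3) / 2, whereas
  Chebyshev's bound makes n at least about N ln 2 / ln N. With ln N bounded by a multiple of
  N^(1/6), the two collide.\<close>

lemma card_primes_gt:
  fixes N :: nat
  assumes "N \<ge> 4096"
  shows "card {p. prime p \<and> p ^ 3 < N\<^sup>2} + 3 * card {p. prime p \<and> p\<^sup>2 < N}
    < card {p. prime p \<and> p < N}"
proof (rule ccontr)
  define n where "n = card {p. prime p \<and> p < N}"
  \<comment> \<open>The sixth root turns N^(2/3) and N^(1/2) into \<open>s ^ 4\<close> and
    \<open>s ^ 3\<close>; since 4096 = 4^6, it is at least 4.\<close>
  define s where "s = root 6 (real N)"
  assume "\<not> ?thesis"
  then have n_le: "real n \<le> real (card {p. prime p \<and> p ^ 3 < N\<^sup>2}) +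
      3 * real (card {p. prime p \<and> p\<^sup>2 < N})"
    unfolding n_def by linarith
  have s6: "s ^ 6 = real N" unfolding s_def by simp
  have "root 6 (4 ^ 6) \<le> s"
    unfolding s_def using assms by (subst real_root_le_iff) auto
  then have s4: "s \<ge> 4"
    by (subst (asm) real_root_power_cancel) auto
  have "{p. prime p \<and> p ^ 3 < N\<^sup>2} \<subseteq> {p. prime p \<and> real p \<le> s ^ 4}"
  proof clarify
    fix p :: nat assume "p ^ 3 < N\<^sup>2"
    then have "real (p ^ 3) < real (N\<^sup>2)" by (simp only: of_nat_less_iff)
    also have "\<dots> = (s ^ 4) ^ 3" by (simp flip: s6 power_mult)
    finally have "real p ^ 3 < (s ^ 4) ^ 3" by (simp only: of_nat_power)
    then have "real p < s ^ 4"
      by (rule power_less_imp_less_base) (use s4 in auto)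
    then show "real p \<le> s ^ 4" by simp
  qed
  moreover have fin: "finite {p. prime p \<and> real p \<le> y}" for y
    by (rule finite_subset[of _ "{..nat \<lfloor>y\<rfloor>}"]) (auto simp: le_nat_floor)
  ultimately have "real (card {p. prime p \<and> p ^ 3 < N\<^sup>2}) \<le>
      real (card {p::nat. prime p \<and> real p \<le> s ^ 4})"
    by (intro of_nat_mono card_mono)
  moreover have "real (card {p::nat. prime p \<and> real p \<le> s ^ 4}) \<le> (s ^ 4 + 1) / 2"
    using s4 by (intro card_primes_le_real) auto
  moreover have "{p. prime p \<and> p\<^sup>2 < N} \<subseteq> {p. prime p \<and> real p \<le> s ^ 3}"
  proof clarify
    fix p :: nat assume "p\<^sup>2 < N"
    then have "real (p\<^sup>2) < real N" by (simp only: of_nat_less_iff)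
    also have "\<dots> = (s ^ 3)\<^sup>2" by (simp flip: s6 power_mult)
    finally have "real p ^ 2 < (s ^ 3) ^ 2" by (simp only: of_nat_power)
    then have "real p < s ^ 3"
      by (rule power_less_imp_less_base) (use s4 in auto)
    then show "real p \<le> s ^ 3" by simp
  qed
  then have "real (card {p. prime p \<and> p\<^sup>2 < N}) \<le>
      real (card {p::nat. prime p \<and> real p \<le> s ^ 3})"
    by (intro of_nat_mono card_mono fin)
  moreover have "real (card {p::nat. prime p \<and> real p \<le> s ^ 3}) \<le> (s ^ 3 + 1) / 2"
    using s4 by (intro card_primes_le_real) auto
  ultimately have n_le': "real n \<le> (s ^ 4 + 3 * s ^ 3 + 4) / 2"
    using n_le by argo

  \<comment> \<open>2m is the largest even number below N, so primes up to 2m are counted by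
    \<open>n\<close>.\<close>
  define m where "m = (N - 1) div 2"
  have m: "m \<ge> 1" "2 * m < N" "N \<le> 2 * m + 2" using assms by (auto simp: m_def)
  have "(2::nat) ^ N \<le> 2 ^ (2 * m + 2)" using m by (intro power_increasing) auto
  also have "\<dots> = 4 * 4 ^ m" by (simp add: power_mult)
  also have "\<dots> \<le> 4 * (2 * (2 * m) ^ card {p. prime p \<and> p \<le> 2 * m})"
    using power_card_primes_ge[OF m(1)] by (rule mult_left_mono) simp
  also have "(2 * m) ^ card {p. prime p \<and> p \<le> 2 * m} \<le> N ^ card {p. prime p \<and> p \<le> 2 * m}"
    using m by (intro power_mono) auto
  also have "\<dots> \<le> N ^ n"
    unfolding n_def using m by (intro power_increasing card_mono) auto
  \<comment> \<open>Of the factor 2^3, rounding N down to 2m costs 4 and the Chebyshev bound costs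
    2.\<close>
  finally have "(2::nat) ^ N \<le> 2 ^ 3 * N ^ n" by simp
  then have "real (2 ^ N) \<le> real (2 ^ 3 * N ^ n)" by (simp only: of_nat_le_iff)
  then have "ln ((2::real) ^ N) \<le> ln (2 ^ 3 * real N ^ n)"
    using assms by (subst ln_le_cancel_iff) auto
  then have "real N * ln 2 \<le> 3 * ln 2 + real n * ln (real N)"
    using assms ln_realpow[of "2::real" 3] by (simp add: ln_mult ln_realpow)
  moreover have "ln (real N) = 6 * ln s"
    using s4 by (simp flip: s6 add: ln_realpow)
  \<comment> \<open>Both sides agree at s = 4. The tangent of ln there has slope 1/4, which is at
    most (ln 2) / 2. A multiple of ln 2 is chosen so that ln 2 cancels from the whole inequality
    below.\<close>
  moreover have "ln s \<le> ln 2 * s / 2"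
  proof -
    have "ln (s / 4) \<le> s / 4 - 1" using s4 by (intro ln_le_minus_one) auto
    moreover have "ln (s / 4) = ln s - 2 * ln 2"
      using s4 ln_realpow[of "2::real" 2] by (simp add: ln_div)
    moreover have "ln 2 \<ge> (1 / 2 :: real)"
      using ln_le_minus_one[of "1 / 2 :: real"] by (simp add: ln_div)
    then have "(1 / 2) * (s / 2 - 2) \<le> ln 2 * (s / 2 - 2)"
      using s4 by (intro mult_right_mono) auto
    ultimately show ?thesis by (simp add: algebra_simps)
  qed
  ultimately have "real N * ln 2 \<le> 3 * ln 2 + real n * (6 * (ln 2 * s / 2))"
    by (smt (verit) mult_left_mono of_nat_0_le_iff)
  also have "\<dots> = (3 + 3 * real n * s) * ln 2" by (simp add: algebra_simps)
  finally have "real N \<le> 3 + 3 * real n * s" by simp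
  also have "\<dots> \<le> 3 + 3 * ((s ^ 4 + 3 * s ^ 3 + 4) / 2) * s"
    using n_le' s4 by (intro add_left_mono mult_right_mono mult_left_mono) auto
  finally have upper: "s ^ 6 \<le> 3 + 3 / 2 * s ^ 5 + 9 / 2 * s ^ 4 + 6 * s"
    unfolding s6 by (simp add: algebra_simps add_divide_distrib eval_nat_numeral)
  \<comment> \<open>Replacing each power by a quarter of the next makes the final contradiction
    linear in the powers of \<open>s\<close>.\<close>
  have step: "4 * s ^ k \<le> s ^ l" if "l = Suc k" for k l
    using s4 that by (simp add: mult_right_mono)
  have "4 * s ^ 5 \<le> s ^ 6" "4 * s ^ 4 \<le> s ^ 5" "4 * s ^ 3 \<le> s ^ 4" "4 * s ^ 2 \<le> s ^ 3"
    "4 * s ^ 1 \<le> s ^ 2"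
    by (rule step; simp)+
  with upper s4 show False by simp
qed

lemma prod_primes_gt_of_large:
  fixes N :: nat
  assumes "N \<ge> 4096"
  shows "N ^ card {p. prime p \<and> p < N} < (\<Prod>{p. prime p \<and> p < N})\<^sup>2"
proof -
  let ?Q = "{p. prime p \<and> p < N}"
  define A where "A = {p. prime p \<and> p\<^sup>2 < N}"
  define D where "D = {p. prime p \<and> p ^ 3 < N\<^sup>2}"
  have AD: "A \<subseteq> D"
  proof (clarsimp simp: A_def D_def)
    fix p :: nat assume "p\<^sup>2 < N"
    moreover have "p \<le> p\<^sup>2" by (simp add: power2_eq_square)
    ultimately have "p\<^sup>2 < N" "p < N" by linarith+
    then have "p\<^sup>2 * p < N * N" by (intro mult_strict_mono) auto
    then show "p ^ 3 < N\<^sup>2" by (simp add: power3_eq_cube power2_eq_square)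
  qed
  have DQ: "D \<subseteq> ?Q"
  proof (clarsimp simp: D_def)
    fix p :: nat assume less: "p ^ 3 < N\<^sup>2"
    show "p < N"
    proof (rule ccontr)
      assume "\<not> p < N"
      then have "N ^ 3 \<le> p ^ 3" by (intro power_mono) auto
      moreover have "N\<^sup>2 \<le> N ^ 3" using assms by (intro power_increasing) auto
      ultimately show False using less by linarith
    qed
  qed
  have fin: "finite ?Q" "finite D" "finite A"
    using finite_subset[OF DQ] finite_subset[OF order_trans[OF AD DQ]] by simp_all
  \<comment> \<open>The weight is an exponent with N^(w p) <= p^6. Sixth powers keep it integral:
    p^3 >= N^2 gives 4, p^2 >= N gives 3, the break-even value.\<close>
  define w where "w p = (if p \<in> A then 0 else if p \<in> D then 3 else 4 :: nat)" for p
  have "(\<Sum>p\<in>?Q. w p) = (\<Sum>p\<in>?Q - D. w p) + ((\<Sum>p\<in>D - A. w p) + (\<Sum>p\<in>A. w p))"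
    using AD DQ fin by (simp add: sum.subset_diff)
  also have "(\<Sum>p\<in>?Q - D. w p) = (\<Sum>p\<in>?Q - D. 4)"
    by (rule sum.cong) (use AD in \<open>auto simp: w_def\<close>)
  also have "(\<Sum>p\<in>D - A. w p) = (\<Sum>p\<in>D - A. 3)"
    by (rule sum.cong) (auto simp: w_def)
  also have "(\<Sum>p\<in>A. w p) = 0" by (simp add: w_def)
  finally have "(\<Sum>p\<in>?Q. w p) = 4 * card (?Q - D) + 3 * card (D - A)"
    by simp
  moreover have "card (?Q - D) = card ?Q - card D" "card (D - A) = card D - card A"
    using AD DQ fin by (auto intro: card_Diff_subset)
  moreover have "card A \<le> card D" "card D \<le> card ?Q"
    using AD DQ fin by (auto intro: card_mono)
  moreover have "card D + 3 * card A < card ?Q"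
    unfolding A_def D_def using card_primes_gt[OF assms] .
  \<comment> \<open>The total weight is 4|Q| - |D| - 3|A|, so it exceeds 3|Q| exactly when |D| +
    3|A| < |Q|.\<close>
  ultimately have "3 * card ?Q < (\<Sum>p\<in>?Q. w p)" by linarith
  then have "(N ^ card ?Q) ^ 3 < N ^ (\<Sum>p\<in>?Q. w p)"
    using assms by (simp flip: power_mult add: mult.commute)
  also have "\<dots> = (\<Prod>p\<in>?Q. N ^ w p)" by (simp add: power_sum)
  also have "\<dots> \<le> (\<Prod>p\<in>?Q. p ^ 6)"
  proof (intro prod_mono conjI)
    fix p assume p: "p \<in> ?Q"
    consider "p \<in> A" | "p \<notin> A" "p \<in> D" | "p \<notin> A" "p \<notin> D" by blast
    then show "N ^ w p \<le> p ^ 6"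
    proof cases
      case 1
      then show ?thesis using p by (simp add: w_def prime_gt_0_nat Suc_leI)
    next
      case 2
      then have "N ^ 3 \<le> (p\<^sup>2) ^ 3" using p by (intro power_mono) (auto simp: A_def)
      then show ?thesis using 2 by (simp add: w_def flip: power_mult)
    next
      case 3
      then have "(N\<^sup>2)\<^sup>2 \<le> (p ^ 3)\<^sup>2" using p by (intro power_mono) (auto simp: D_def)
      then show ?thesis using 3 by (simp add: w_def flip: power_mult)
    qed
  qed simp
  also have "\<dots> = ((\<Prod>?Q)\<^sup>2) ^ 3"
    by (simp add: prod_power_distrib flip: power_mult)
  finally show ?thesis by (rule power_less_imp_less_base) simp
qed

section \<open>Small N, by explicit sets of primes\<close>

text \<open>Trial division: a composite number has two prime factors whose product divides it, and
  if both are at least \<open>c\<close> it is at least c^2.\<close>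

lemma prime_if_no_small_prime_divisor:
  fixes p c :: nat
  assumes "1 < p" "p < c\<^sup>2" and no_div: "\<And>q. prime q \<Longrightarrow> q < c \<Longrightarrow> \<not> q dvd p"
  shows "prime p"
proof (rule ccontr)
  assume "\<not> prime p"
  obtain q where q: "prime q" "q dvd p"
    using prime_factor_nat[of p] assms(1) by auto
  from q(2) obtain r where r: "p = q * r" by (elim dvdE)
  with \<open>\<not> prime p\<close> q(1) have "r \<noteq> 1" by auto
  then obtain q' where q': "prime q'" "q' dvd r"
    using prime_factor_nat by blast
  have "q' dvd p" using q'(2) r by simp
  then have "c \<le> q" "c \<le> q'"
    using no_div q q'(1) by (meson not_le)+
  have "q * q' dvd p" using r q'(2) by simp
  have "c\<^sup>2 \<le> q * q'" using \<open>c \<le> q\<close> \<open>c \<le> q'\<close> by (simp add: power2_eq_square mult_le_mono)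
  also have "q * q' \<le> p"
    using \<open>q * q' dvd p\<close> by (rule dvd_imp_le) (use assms(1) in simp)
  finally show False using assms(2) by simp
qed

text \<open>As the set is fixed, one numerical check at the right end \<open>b\<close> serves all N
  from \<open>a\<close> to \<open>b\<close>. The primes in \<open>A\<close> play two roles: they are
  the trial divisors certifying \<open>B\<close>, as a <= c^2, and they include every prime with p^2
  < N, as b <= c^2.\<close>

lemma prod_primes_gt_of_interval:
  fixes N a b c d :: nat and A B :: "nat set"
  assumes "a \<le> N" "N \<le> b"
    and A: "{p. prime p \<and> p < c} = A" and B: "\<forall>p\<in>B. 1 < p \<and> p < a \<and> (\<forall>q\<in>A. \<not> q dvd p)"
    and c: "c \<le> a" "a \<le> c\<^sup>2" "b \<le> c\<^sup>2"
    and card: "card (A \<union> B) = d" and gt: "b ^ d < (\<Prod>(A \<union> B))\<^sup>2"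
  shows "N ^ card {p. prime p \<and> p < N} < (\<Prod>{p. prime p \<and> p < N})\<^sup>2"
proof (rule prod_primes_gt_of_subset)
  have "prime p" if "p \<in> B" for p
    by (rule prime_if_no_small_prime_divisor[of _ c]) (use that A B c in auto)
  then show "A \<union> B \<subseteq> {p. prime p \<and> p < N}"
    using A B c(1) assms(1) by fastforce
  show "{p. prime p \<and> p\<^sup>2 < N} \<subseteq> A \<union> B"
  proof clarify
    fix p :: nat assume p: "prime p" "p\<^sup>2 < N" "p \<notin> B"
    then have "p\<^sup>2 < c\<^sup>2" using assms(2) c(3) by linarith
    then have "p < c" by (rule power_less_imp_less_base) simp
    with p(1) A show "p \<in> A" by blast
  qed
  have "N ^ d \<le> b ^ d" using assms(2) by (intro power_mono) auto
  also note gt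
  finally show "N ^ card (A \<union> B) < (\<Prod>(A \<union> B))\<^sup>2" unfolding card .
qed

text \<open>67 is the least prime whose square exceeds 4096, so these primes suffice for every N
  left to the explicit sets.\<close>

lemma primes_less_67:
  "{p::nat. prime p \<and> p < 67} =
    {2, 3, 5, 7, 11, 13, 17, 19, 23, 29, 31, 37, 41, 43, 47, 53, 59, 61}" (is "_ = ?A")
proof
  have "\<forall>p\<in>{..<67}. prime p \<longrightarrow> p \<in> ?A"
    by (simp add: lessThan_nat_numeral)
  then show "{p. prime p \<and> p < 67} \<subseteq> ?A" by blast
  show "?A \<subseteq> {p. prime p \<and> p < 67}" by simp
qed

lemma primes_less_of_le_67:
  assumes "c \<le> 67"
  shows "{p::nat. prime p \<and> p < c} =
    {p \<in> {2, 3, 5, 7, 11, 13, 17, 19, 23, 29, 31, 37, 41, 43, 47, 53, 59, 61}. p < c}"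
  unfolding primes_less_67[symmetric] using assms by auto

lemma prod_primes_gt:
  fixes N :: nat
  assumes "N \<ge> 30"
  shows "N ^ card {p. prime p \<and> p < N} < (\<Prod>{p. prime p \<and> p < N})\<^sup>2"
proof -
  \<comment> \<open>Each right end is at most c^2 for the \<open>c\<close> of its case; 1369 = 37^2
    and 4489 = 67^2 attain this.\<close>
  consider "30 \<le> N" "N \<le> 90" | "90 \<le> N" "N \<le> 330" | "330 \<le> N" "N \<le> 1369"
    | "1369 \<le> N" "N \<le> 4489" | "4096 \<le> N"
    using assms by linarith
  then show ?thesis
  proof cases
    case 1
    have "{p::nat. prime p \<and> p < 10} = {2, 3, 5, 7}"
      by (subst primes_less_of_le_67) auto
    then show ?thesis
      by (rule prod_primes_gt_of_interval[OF 1, where d = 10 and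
            B = "{11, 13, 17, 19, 23, 29}"]) simp_all
  next
    case 2
    have "{p::nat. prime p \<and> p < 19} = {2, 3, 5, 7, 11, 13, 17}"
      by (subst primes_less_of_le_67) auto
    \<comment> \<open>Here and in the other explicit cases \<open>B\<close> consists of the largest
      primes below the left end, since these gain most from p^2 / N.\<close>
    then show ?thesis
      by (rule prod_primes_gt_of_interval[OF 2, where d = 12 and
            B = "{71, 73, 79, 83, 89}"]) simp_all
  next
    case 3
    have "{p::nat. prime p \<and> p < 37} = {2, 3, 5, 7, 11, 13, 17, 19, 23, 29, 31}"
      by (subst primes_less_of_le_67) auto
    then show ?thesis
      by (rule prod_primes_gt_of_interval[OF 3, where d = 18 and
            B = "{281, 283, 293, 307, 311, 313, 317}"]) simp_all
  next
    case 4
    show ?thesis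
      by (rule prod_primes_gt_of_interval[OF 4 primes_less_67, where d = 26 and
            B = "{1301, 1303, 1307, 1319, 1321, 1327, 1361, 1367}"]) simp_all
  next
    case 5
    then show ?thesis by (rule prod_primes_gt_of_large)
  qed
qed

section \<open>Passage to the sequence of primes\<close>

text \<open>Positive indices exclude the junk value at 0, which repeats the value at 1.\<close>

lemma nth_prime_mono_iff:
  assumes "i \<ge> 1" "j \<ge> 1"
  shows "nth_prime i < nth_prime j \<longleftrightarrow> i < j"
proof -
  have "nth_prime i < nth_prime j \<longleftrightarrow> i - 1 < j - 1"
    unfolding nth_prime_def by (rule enumerate_mono_iff[OF primes_infinite])
  with assms show ?thesis by auto
qed

text \<open>This turns the cardinality and the product over the primes below p_(n+1) into n and p_1
  ... p_n.\<close>

lemma bij_betw_nth_prime_less: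
  "bij_betw nth_prime {1..n} {p. prime p \<and> p < nth_prime (n + 1)}"
proof (rule bij_betw_subset[OF bij_betw_nth_prime])
  show "nth_prime ` {1..n} = {p. prime p \<and> p < nth_prime (n + 1)}"
  proof (intro set_eqI iffI)
    fix p assume "p \<in> {p. prime p \<and> p < nth_prime (n + 1)}"
    moreover from this obtain i where "i \<ge> 1" "p = nth_prime i"
      using bij_betw_imp_surj_on[OF bij_betw_nth_prime] by auto
    ultimately show "p \<in> nth_prime ` {1..n}"
      by (auto simp: nth_prime_mono_iff)
  next
    fix p assume "p \<in> nth_prime ` {1..n}"
    then show "p \<in> {p. prime p \<and> p < nth_prime (n + 1)}"
      using bij_betw_imp_surj_on[OF bij_betw_nth_prime]
      by (auto simp: nth_prime_mono_iff)
  qed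
qed auto

theorem mainTheorem3:
  fixes k n :: nat
  assumes "k \<ge> 5" and "n \<ge> 2 * k"
  shows "(\<Prod>i=1..n. nth_prime i) > nth_prime (n + 1) ^ k"
proof -
  let ?N = "nth_prime (n + 1)" and ?P = "\<Prod>i=1..n. nth_prime i"
  let ?Q = "{p. prime p \<and> p < ?N}"
  have bij: "bij_betw nth_prime {1..n} ?Q" by (rule bij_betw_nth_prime_less)
  have card: "card ?Q = n" using bij_betw_same_card[OF bij] by simp
  have prod: "\<Prod>?Q = ?P" using prod.reindex_bij_betw[OF bij, of "\<lambda>p. p"] by simp
  \<comment> \<open>Otherwise the primes below N would be among the nine below 29, but there are n
    >= 10 of them.\<close>
  have "?N \<ge> 30"
  proof (rule ccontr)
    assume "\<not> ?N \<ge> 30"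
    then have "?Q \<subseteq> {p. prime p \<and> p < 67} \<inter> {..<29}" by auto
    also have "\<dots> = {2, 3, 5, 7, 11, 13, 17, 19, 23}" unfolding primes_less_67 by auto
    finally have "card ?Q \<le> card {2, 3, 5, 7, 11, 13, 17, 19, 23 :: nat}"
      by (intro card_mono) auto
    with card assms show False by simp
  qed
  then have "?N ^ n < ?P\<^sup>2" using prod_primes_gt[of ?N] by (simp only: card prod)
  \<comment> \<open>With 2k <= n the exponent drops to an even one, and square roots give the
    claim.\<close>
  moreover have "?N ^ (2 * k) \<le> ?N ^ n"
    using assms \<open>?N \<ge> 30\<close> by (intro power_increasing) auto
  ultimately have "(?N ^ k)\<^sup>2 < ?P\<^sup>2" by (simp add: mult.commute flip: power_mult)
  then show ?thesis by (rule power_less_imp_less_base) simp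
qed

end
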